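(* Let $V$ be uniformly distributed in the rectangle $\mathfrak{R}(o)=[-\ell_x/2,\ell_x/2]\times[-\ell_y/2,\ell_y/2]$, with $\ell_x,\ell_y>0$, and let $u=(u_x,u_y)$ be a fixed reference point with $|u_x|<\ell_x/2$ and $|u_y|<\ell_y/2$. Let $(R,\Theta)$ be the distance and azimuth angle of $V$ as seen from $u$, i.e. $V-u=(R\cos\Theta,R\sin\Theta)$ with $R\ge 0$, $\Theta\in[0,2\pi)$. Then $(R,\Theta)$ has the joint probability density function (with respect to Lebesgue measure on $(0,\infty)\times[0,2\pi)$) $$f_{R,\Theta}(r,\theta)=\frac{r}{\ell_x\ell_y}\sum_{i=1}^{8}\Big(\mathbf 1(r<h_i)\,\mathbf 1_{[\chi^{(<)}_{i,1},\,\chi^{(<)}_{i,2})}(\theta)+\mathbf 1(r\ge h_i)\,\mathbf 1_{[\chi^{(\ge)}_{i,1}(r),\,\chi^{(\ge)}_{i,2}(r))}(\theta)\Big),$$ with $h_i,\chi^{(<)}_{i,j},\chi^{(\ge)}_{i,j}(r)$ as defined in the context.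
   Context: $\mathbf 1(\cdot)$ is the indicator of a condition, $\mathbf 1_A(\cdot)$ the indicator function of a set $A$; $[a,b)=\emptyset$ if $a\ge b$; a term multiplied by an indicator equal to $0$ is read as $0$. Let $h_{x^+}=\frac{\ell_x}{2}-u_x$, $h_{x^-}=-\frac{\ell_x}{2}-u_x$, $h_{y^+}=\frac{\ell_y}{2}-u_y$, $h_{y^-}=-\frac{\ell_y}{2}-u_y$, and $(h_1,\dots,h_8)=(h_{x^+},h_{x^+},-h_{x^-},-h_{x^-},h_{y^+},h_{y^+},-h_{y^-},-h_{y^-})$. Let $\gamma_1=\arctan(h_{y^+}/h_{x^+})$, $\gamma_2=\arctan(h_{y^+}/h_{x^-})+\pi$, $\gamma_3=\arctan(h_{y^-}/h_{x^-})+\pi$, $\gamma_4=\arctan(h_{y^-}/h_{x^+})+2\pi$. The pairs $(\chi^{(<)}_{i,1},\chi^{(<)}_{i,2})$ for $i=1,\dots,8$ are: $(0,\gamma_1)$, $(\gamma_4,2\pi)$, $(\pi,\gamma_3)$, $(\gamma_2,\pi)$, $(\gamma_1,\frac{\pi}{2})$, $(\frac{\pi}{2},\gamma_2)$, $(\gamma_3,\frac{3\pi}{2})$, $(\frac{3\pi}{2},\gamma_4)$. For $r\ge h_i$, the pairs $(\chi^{(\ge)}_{i,1}(r),\chi^{(\ge)}_{i,2}(r))$ are: $i=1$: $(\arccos\frac{h_{x^+}}{r},\gamma_1)$; $i=2$: $(\gamma_4,2\pi-\arccos\frac{h_{x^+}}{r})$; $i=3$: $(2\pi-\arccos\frac{h_{x^-}}{r},\gamma_3)$;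 $i=4$: $(\gamma_2,\arccos\frac{h_{x^-}}{r})$; $i=5$: $(\gamma_1,\arcsin\frac{h_{y^+}}{r})$; $i=6$: $(\pi-\arcsin\frac{h_{y^+}}{r},\gamma_2)$; $i=7$: $(\gamma_3,\pi-\arcsin\frac{h_{y^-}}{r})$; $i=8$: $(2\pi+\arcsin\frac{h_{y^-}}{r},\gamma_4)$. *)

theory Defs
  imports "HOL-Probability.Probability"
begin

context
  fixes lx ly ux uy :: real
begin

definition hx_plus :: real where "hx_plus = lx / 2 - ux"
definition hx_minus :: real where "hx_minus = - lx / 2 - ux"
definition hy_plus :: real where "hy_plus = ly / 2 - uy"
definition hy_minus :: real where "hy_minus = - ly / 2 - uy"

text \<open>The families below are meaningful for indices \<open>1, \<dots>, 8\<close>; lists are indexed from 0.\<close>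

definition h :: "nat \<Rightarrow> real" where
  "h i = [hx_plus, hx_plus, - hx_minus, - hx_minus,
          hy_plus, hy_plus, - hy_minus, - hy_minus] ! (i - 1)"

definition gamma1 :: real where "gamma1 = arctan (hy_plus / hx_plus)"
definition gamma2 :: real where "gamma2 = arctan (hy_plus / hx_minus) + pi"
definition gamma3 :: real where "gamma3 = arctan (hy_minus / hx_minus) + pi"
definition gamma4 :: real where "gamma4 = arctan (hy_minus / hx_plus) + 2 * pi"

definition chi_less :: "nat \<Rightarrow> real \<times> real" where
  "chi_less i =
    [(0, gamma1),
     (gamma4, 2 * pi),
     (pi, gamma3),
     (gamma2, pi),
     (gamma1, pi / 2),
     (pi / 2, gamma2),
     (gamma3, 3 * pi / 2),
     (3 * pi / 2, gamma4)] ! (i - 1)"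

text \<open>Only used for \<open>r \<ge> h i\<close>: there the arguments of \<open>arccos\<close> and \<open>arcsin\<close> lie in
  \<open>[-1, 1]\<close>, whereas otherwise their values are unspecified.\<close>

definition chi_geq :: "nat \<Rightarrow> real \<Rightarrow> real \<times> real" where
  "chi_geq i r =
    [(arccos (hx_plus / r), gamma1),
     (gamma4, 2 * pi - arccos (hx_plus / r)),
     (2 * pi - arccos (hx_minus / r), gamma3),
     (gamma2, arccos (hx_minus / r)),
     (gamma1, arcsin (hy_plus / r)),
     (pi - arcsin (hy_plus / r), gamma2),
     (gamma3, pi - arcsin (hy_minus / r)),
     (2 * pi + arcsin (hy_minus / r), gamma4)] ! (i - 1)"

definition polar_density :: "real \<Rightarrow> real \<Rightarrow> real" where
  "polar_density r \<theta> =
    r / (lx * ly) *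
      (\<Sum>i = 1..8.
          of_bool (r < h i) * indicator {fst (chi_less i)..<snd (chi_less i)} \<theta>
        + of_bool (r \<ge> h i) * indicator {fst (chi_geq i r)..<snd (chi_geq i r)} \<theta>)"

end

end

theory Submission imports Defs
begin

text \<open>Away from the null event \<open>V = u\<close>, the pair \<open>(R, \<Theta>)\<close> is an explicit Borel function of \<open>V - u\<close>.
  Integrating in polar coordinates, its density is therefore \<open>r / (\<ell>\<^sub>x \<ell>\<^sub>y)\<close> times the
  indicator that \<open>u + r (cos \<theta>, sin \<theta>)\<close> lies in the rectangle. The angles \<open>\<gamma>\<^sub>1, \<dots>, \<gamma>\<^sub>4\<close> are the
  directions of the corners, and between consecutive multiples of \<open>\<pi>/2\<close> and corner directions only
  one side of the rectangle can be crossed: each of the eight summands is the condition that this side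
  has not been crossed yet.\<close>

section \<open>Integration in polar coordinates\<close>

text \<open>Outside \<open>[-1, 1]\<close> the defining descriptions of \<open>arccos\<close> and \<open>arcsin\<close> are
  unsatisfiable, so there both functions are constant, equal to \<open>THE x. False\<close>.\<close>

lemma borel_measurable_arccos [measurable]: "arccos \<in> borel_measurable borel"
proof -
  have "(\<lambda>y. if y \<in> {-1..1} then arccos y else (THE x. False)) \<in> borel_measurable borel"
    by (rule borel_measurable_continuous_on_if) (auto intro: continuous_on_arccos')
  also have "(\<lambda>y. if y \<in> {-1..1} then arccos y else (THE x. False)) = arccos"
  proof (rule ext)
    fix y :: real
    have "arccos y = (THE x. False)" if "y \<notin> {-1..1}"
      unfolding arccos_def using that cos_ge_minus_one cos_le_one
      by (intro arg_cong[where f = The]) (auto simp: fun_eq_iff)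
    then show "(if y \<in> {-1..1} then arccos y else (THE x. False)) = arccos y" by simp
  qed
  finally show ?thesis .
qed

lemma borel_measurable_arcsin [measurable]: "arcsin \<in> borel_measurable borel"
proof -
  have "(\<lambda>y. if y \<in> {-1..1} then arcsin y else (THE x. False)) \<in> borel_measurable borel"
    by (rule borel_measurable_continuous_on_if) (auto intro: continuous_on_arcsin')
  also have "(\<lambda>y. if y \<in> {-1..1} then arcsin y else (THE x. False)) = arcsin"
  proof (rule ext)
    fix y :: real
    have "arcsin y = (THE x. False)" if "y \<notin> {-1..1}"
      unfolding arcsin_def using that sin_ge_minus_one sin_le_one
      by (intro arg_cong[where f = The]) (auto simp: fun_eq_iff)
    then show "(if y \<in> {-1..1} then arcsin y else (THE x. False)) = arcsin y" by simp
  qed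
  finally show ?thesis .
qed

text \<open>\<open>tan\<close> is continuously differentiable on every compact subinterval of
  (-pi/2, pi/2). Substitution on the intervals with endpoints \<open>-?a n\<close> and
  \<open>?a n\<close>, which \<open>tan\<close> maps onto [-(n+1), n+1], gives the claim for
  truncated integrands, and monotone convergence on both sides removes the truncation.\<close>

lemma nn_integral_tan_substitution:
  fixes f :: "real \<Rightarrow> ennreal"
  assumes [measurable]: "f \<in> borel_measurable borel"
  shows "(\<integral>\<^sup>+t. f t \<partial>lborel) =
    (\<integral>\<^sup>+\<theta>. f (tan \<theta>) * ennreal (inverse ((cos \<theta>)\<^sup>2)) * indicator {-pi/2<..<pi/2} \<theta> \<partial>lborel)"
proof -
  \<comment> \<open>\<open>Suc n\<close> instead of \<open>n\<close> keeps the interval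
    nondegenerate at \<open>n = 0\<close>, as the substitution rule demands.\<close>
  let ?a = "\<lambda>n. arctan (real (Suc n))"
  let ?F = "\<lambda>n t. f t * indicator {-real (Suc n)..real (Suc n)} t"
  let ?G = "\<lambda>n \<theta>. f (tan \<theta>) * ennreal (inverse ((cos \<theta>)\<^sup>2)) * indicator {-?a n..?a n} \<theta>"
  have [measurable]: "(tan :: real \<Rightarrow> real) \<in> borel_measurable borel"
    unfolding tan_def by measurable
  have eq: "(\<integral>\<^sup>+t. ?F n t \<partial>lborel) = (\<integral>\<^sup>+\<theta>. ?G n \<theta> \<partial>lborel)" for n
  proof -
    have cos_nz: "cos x \<noteq> 0" if "x \<in> {-?a n..?a n}" for x
    proof -
      have "cos x > 0" using that arctan_ubound[of "real (Suc n)"]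
        by (intro cos_gt_zero_pi) auto
      then show ?thesis by simp
    qed
    have "(\<integral>\<^sup>+t. f t * indicator {tan (-?a n)..tan (?a n)} t \<partial>lborel) = (\<integral>\<^sup>+\<theta>. ?G n \<theta> \<partial>lborel)"
    proof (rule nn_integral_substitution_aux)
      show "(tan has_real_derivative inverse ((cos x)\<^sup>2)) (at x)" if "x \<in> {-?a n..?a n}" for x
        using cos_nz[OF that] by (rule DERIV_tan)
      show "continuous_on {-?a n..?a n} (\<lambda>x. inverse ((cos x)\<^sup>2))"
        by (intro continuous_intros) (use cos_nz in auto)
      have "0 < ?a n" by simp
      then show "-?a n < ?a n" by linarith
    qed simp_all
    then show ?thesis by (simp only: tan_minus tan_arctan)
  qed
  have "(\<integral>\<^sup>+t. f t \<partial>lborel) = (\<integral>\<^sup>+t. (SUP n. ?F n t) \<partial>lborel)"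
  proof (rule nn_integral_cong)
    fix t :: real
    obtain n where n: "\<bar>t\<bar> \<le> real n" using real_arch_simple by blast
    then have "f t = ?F n t" by (auto split: split_indicator)
    show "f t = (SUP n. ?F n t)"
    proof (rule antisym)
      show "f t \<le> (SUP n. ?F n t)"
        by (rule SUP_upper2[of n]) (use \<open>f t = ?F n t\<close> in auto)
      have "?F n t \<le> f t" for n by (auto split: split_indicator)
      then show "(SUP n. ?F n t) \<le> f t" by (rule SUP_least)
    qed
  qed
  also have "\<dots> = (SUP n. \<integral>\<^sup>+t. ?F n t \<partial>lborel)"
    by (rule nn_integral_monotone_convergence_SUP)
       (auto simp: incseq_def le_fun_def split: split_indicator)
  also have "\<dots> = (SUP n. \<integral>\<^sup>+\<theta>. ?G n \<theta> \<partial>lborel)"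
    by (simp only: eq)
  also have "\<dots> = (\<integral>\<^sup>+\<theta>. (SUP n. ?G n \<theta>) \<partial>lborel)"
  proof (rule nn_integral_monotone_convergence_SUP[symmetric])
    have "?G m \<theta> \<le> ?G n \<theta>" if "m \<le> n" for m n \<theta>
    proof -
      have "?a m \<le> ?a n" using that by (simp add: arctan_le_iff)
      then have "{-?a m..?a m} \<subseteq> {-?a n..?a n}" by auto
      then show ?thesis by (intro mult_left_mono) (auto split: split_indicator)
    qed
    then show "incseq ?G" unfolding incseq_def le_fun_def by blast
  qed auto
  also have "\<dots> = (\<integral>\<^sup>+\<theta>. f (tan \<theta>) * ennreal (inverse ((cos \<theta>)\<^sup>2)) * indicator {-pi/2<..<pi/2} \<theta> \<partial>lborel)"
  proof (rule nn_integral_cong)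
    fix x :: real
    show "(SUP n. ?G n x) = f (tan x) * ennreal (inverse ((cos x)\<^sup>2)) * indicator {-pi/2<..<pi/2} x"
      (is "_ = ?R")
    proof (rule antisym)
      have "?G n x \<le> ?R" for n
        using arctan_ubound[of "real (Suc n)"] by (auto split: split_indicator)
      then show "(SUP n. ?G n x) \<le> ?R" by (rule SUP_least)
      show "?R \<le> (SUP n. ?G n x)"
      proof (cases "x \<in> {-pi/2<..<pi/2}")
        case True
        obtain n where n: "\<bar>tan x\<bar> \<le> real n" using real_arch_simple by blast
        have x: "arctan (tan x) = x" using True by (simp add: arctan_tan)
        have "arctan (tan x) \<le> ?a n" "arctan (- real (Suc n)) \<le> arctan (tan x)"
          using n unfolding arctan_le_iff by auto
        then have "x \<in> {-?a n..?a n}" by (simp only: x arctan_minus atLeastAtMost_iff)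
        then show ?thesis by (intro SUP_upper2[of n]) (auto split: split_indicator)
      qed auto
    qed
  qed
  finally show ?thesis .
qed

text \<open>Only one-dimensional substitutions are needed: \<open>y = x t\<close> for fixed \<open>x\<close>, then
  \<open>t = tan \<theta>\<close> after exchanging the integrals, then \<open>x = r cos \<theta>\<close> for fixed \<open>\<theta>\<close>.
  The factors combine to \<open>x (1 / cos\<^sup>2 \<theta>) cos \<theta> = r\<close>.\<close>

lemma nn_integral_polar_right:
  fixes F :: "real \<Rightarrow> real \<Rightarrow> ennreal"
  assumes F [measurable]: "case_prod F \<in> borel_measurable (borel \<Otimes>\<^sub>M borel)"
  shows "(\<integral>\<^sup>+x. \<integral>\<^sup>+y. F x y * indicator {0<..} x \<partial>lborel \<partial>lborel) =
    (\<integral>\<^sup>+\<theta>. (\<integral>\<^sup>+r. F (r * cos \<theta>) (r * sin \<theta>) * ennreal r * indicator {0<..} r \<partial>lborel)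
      * indicator {-pi/2<..<pi/2} \<theta> \<partial>lborel)"
proof -
  have "(\<integral>\<^sup>+x. \<integral>\<^sup>+y. F x y * indicator {0<..} x \<partial>lborel \<partial>lborel) =
    (\<integral>\<^sup>+x. \<integral>\<^sup>+t. F x (x * t) * ennreal x * indicator {0<..} x \<partial>lborel \<partial>lborel)"
  proof (rule nn_integral_cong)
    fix x :: real
    show "(\<integral>\<^sup>+y. F x y * indicator {0<..} x \<partial>lborel) =
      (\<integral>\<^sup>+t. F x (x * t) * ennreal x * indicator {0<..} x \<partial>lborel)"
    proof (cases "x > 0")
      case True
      then have "(\<integral>\<^sup>+y. F x y \<partial>lborel) = ennreal x * (\<integral>\<^sup>+t. F x (x * t) \<partial>lborel)"
        using nn_integral_real_affine[of "F x" x 0] by simp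
      also have "\<dots> = (\<integral>\<^sup>+t. F x (x * t) * ennreal x \<partial>lborel)"
        by (subst nn_integral_cmult[symmetric]) (auto simp: mult.commute)
      finally show ?thesis using True by simp
    qed simp
  qed
  also have "\<dots> = (\<integral>\<^sup>+t. \<integral>\<^sup>+x. F x (x * t) * ennreal x * indicator {0<..} x \<partial>lborel \<partial>lborel)"
    by (rule lborel_pair.Fubini'[symmetric]) measurable
  also have "\<dots> = (\<integral>\<^sup>+\<theta>. (\<integral>\<^sup>+x. F x (x * tan \<theta>) * ennreal x * indicator {0<..} x \<partial>lborel)
      * ennreal (inverse ((cos \<theta>)\<^sup>2)) * indicator {-pi/2<..<pi/2} \<theta> \<partial>lborel)"
    by (rule nn_integral_tan_substitution) measurable
  also have "\<dots> = (\<integral>\<^sup>+\<theta>. (\<integral>\<^sup>+r. F (r * cos \<theta>) (r * sin \<theta>) * ennreal r * indicator {0<..} r \<partial>lborel)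
      * indicator {-pi/2<..<pi/2} \<theta> \<partial>lborel)"
  proof (rule nn_integral_cong)
    fix \<theta> :: real
    show "(\<integral>\<^sup>+x. F x (x * tan \<theta>) * ennreal x * indicator {0<..} x \<partial>lborel)
      * ennreal (inverse ((cos \<theta>)\<^sup>2)) * indicator {-pi/2<..<pi/2} \<theta> =
      (\<integral>\<^sup>+r. F (r * cos \<theta>) (r * sin \<theta>) * ennreal r * indicator {0<..} r \<partial>lborel)
      * indicator {-pi/2<..<pi/2} \<theta>"
    proof (cases "\<theta> \<in> {-pi/2<..<pi/2}")
      case True
      then have c: "cos \<theta> > 0" by (intro cos_gt_zero_pi) auto
      have "(\<integral>\<^sup>+x. F x (x * tan \<theta>) * ennreal x * indicator {0<..} x \<partial>lborel) =
        ennreal (cos \<theta>) * (\<integral>\<^sup>+r. F (cos \<theta> * r) (cos \<theta> * r * tan \<theta>) * ennreal (cos \<theta> * r)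
          * indicator {0<..} (cos \<theta> * r) \<partial>lborel)"
        using c by (subst nn_integral_real_affine[where c = "cos \<theta>" and t = 0]) auto
      \<comment> \<open>The second factor \<open>cos \<theta>\<close> is split off the weight
        \<open>x = r cos \<theta>\<close>; the first is the Jacobian of the scaling. Their product
        cancels the derivative of \<open>tan\<close>.\<close>
      also have "(\<integral>\<^sup>+r. F (cos \<theta> * r) (cos \<theta> * r * tan \<theta>) * ennreal (cos \<theta> * r)
          * indicator {0<..} (cos \<theta> * r) \<partial>lborel) =
        (\<integral>\<^sup>+r. ennreal (cos \<theta>) * (F (r * cos \<theta>) (r * sin \<theta>) * ennreal r * indicator {0<..} r) \<partial>lborel)"
        using c by (intro nn_integral_cong)
          (auto simp: tan_def mult_ac ennreal_mult zero_less_mult_iff split: split_indicator)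
      also have "\<dots> = ennreal (cos \<theta>) *
        (\<integral>\<^sup>+r. F (r * cos \<theta>) (r * sin \<theta>) * ennreal r * indicator {0<..} r \<partial>lborel)"
        by (rule nn_integral_cmult) measurable
      finally have *: "(\<integral>\<^sup>+x. F x (x * tan \<theta>) * ennreal x * indicator {0<..} x \<partial>lborel) =
        ennreal ((cos \<theta>)\<^sup>2) *
        (\<integral>\<^sup>+r. F (r * cos \<theta>) (r * sin \<theta>) * ennreal r * indicator {0<..} r \<partial>lborel)"
        using c by (simp add: power2_eq_square ennreal_mult mult.assoc)
      have "ennreal ((cos \<theta>)\<^sup>2) * ennreal (inverse ((cos \<theta>)\<^sup>2)) = 1"
        using c by (simp flip: ennreal_mult)
      \<comment> \<open>Cancelling between the two finite constants keeps this valid for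
        \<open>I\<close> infinite.\<close>
      then have "ennreal ((cos \<theta>)\<^sup>2) * I * ennreal (inverse ((cos \<theta>)\<^sup>2)) = I" for I
        by (metis mult.assoc mult.commute mult_1)
      then show ?thesis unfolding * by simp
    qed simp
  qed
  finally show ?thesis .
qed

text \<open>The right half plane is the previous lemma; the left one is its image under the point
  reflection, which adds pi to the angle. Angles in (-pi/2, 0) are then moved up by a full turn. The
  axis \<open>x = 0\<close> and its two directions are null sets.\<close>

lemma nn_integral_polar:
  fixes F :: "real \<Rightarrow> real \<Rightarrow> ennreal"
  assumes F [measurable]: "case_prod F \<in> borel_measurable (borel \<Otimes>\<^sub>M borel)"
  shows "(\<integral>\<^sup>+x. \<integral>\<^sup>+y. F x y \<partial>lborel \<partial>lborel) =
    (\<integral>\<^sup>+\<theta>. (\<integral>\<^sup>+r. F (r * cos \<theta>) (r * sin \<theta>) * ennreal r * indicator {0<..} r \<partial>lborel)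
      * indicator {0..<2 * pi} \<theta> \<partial>lborel)"
proof -
  define G where "G \<theta> = (\<integral>\<^sup>+r. F (r * cos \<theta>) (r * sin \<theta>) * ennreal r * indicator {0<..} r \<partial>lborel)" for \<theta>
  have [measurable]: "G \<in> borel_measurable borel" unfolding G_def by measurable
  have periodic: "G (\<theta> - 2 * pi) = G \<theta>" for \<theta> unfolding G_def by (simp add: cos_diff sin_diff)
  have shift: "(\<integral>\<^sup>+\<theta>. g \<theta> \<partial>lborel) = (\<integral>\<^sup>+\<theta>. g (\<theta> - c) \<partial>lborel)"
    if [measurable]: "g \<in> borel_measurable borel" for g :: "real \<Rightarrow> ennreal" and c
    using nn_integral_real_affine[of g 1 "-c"] by (simp add: algebra_simps)
  have flip: "(\<integral>\<^sup>+x. g x \<partial>lborel) = (\<integral>\<^sup>+x. g (-x) \<partial>lborel)"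
    if [measurable]: "g \<in> borel_measurable borel" for g :: "real \<Rightarrow> ennreal"
    using nn_integral_real_affine[of g "-1" 0] by simp
  \<comment> \<open>The point reflection is carried out one coordinate at a time.\<close>
  have "(\<integral>\<^sup>+x. \<integral>\<^sup>+y. F x y * indicator {..<0} x \<partial>lborel \<partial>lborel) =
    (\<integral>\<^sup>+x. \<integral>\<^sup>+y. F (-x) y * indicator {..<0} (-x) \<partial>lborel \<partial>lborel)"
    by (rule flip) measurable
  also have "\<dots> = (\<integral>\<^sup>+x. \<integral>\<^sup>+y. F (-x) (-y) * indicator {..<0} (-x) \<partial>lborel \<partial>lborel)"
    by (intro nn_integral_cong flip) measurable
  also have "\<dots> = (\<integral>\<^sup>+x. \<integral>\<^sup>+y. F (-x) (-y) * indicator {0<..} x \<partial>lborel \<partial>lborel)"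
    by (auto intro!: nn_integral_cong split: split_indicator)
  also have "\<dots> = (\<integral>\<^sup>+\<theta>. (\<integral>\<^sup>+r. F (- (r * cos \<theta>)) (- (r * sin \<theta>)) * ennreal r * indicator {0<..} r \<partial>lborel)
      * indicator {-pi/2<..<pi/2} \<theta> \<partial>lborel)"
    by (rule nn_integral_polar_right) measurable
  also have "\<dots> = (\<integral>\<^sup>+\<theta>. G (\<theta> + pi) * indicator {-pi/2<..<pi/2} \<theta> \<partial>lborel)"
    by (simp add: G_def)
  also have "\<dots> = (\<integral>\<^sup>+\<theta>. G (\<theta> - pi + pi) * indicator {-pi/2<..<pi/2} (\<theta> - pi) \<partial>lborel)"
    by (rule shift) measurable
  also have "\<dots> = (\<integral>\<^sup>+\<theta>. G \<theta> * indicator {pi/2<..<3*pi/2} \<theta> \<partial>lborel)"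
    by (auto intro!: nn_integral_cong split: split_indicator)
  finally have left: "(\<integral>\<^sup>+x. \<integral>\<^sup>+y. F x y * indicator {..<0} x \<partial>lborel \<partial>lborel) =
    (\<integral>\<^sup>+\<theta>. G \<theta> * indicator {pi/2<..<3*pi/2} \<theta> \<partial>lborel)" .
  have "(\<integral>\<^sup>+x. \<integral>\<^sup>+y. F x y * indicator {0<..} x \<partial>lborel \<partial>lborel) =
    (\<integral>\<^sup>+\<theta>. G \<theta> * indicator {-pi/2<..<pi/2} \<theta> \<partial>lborel)"
    unfolding G_def by (rule nn_integral_polar_right) measurable
  also have "\<dots> = (\<integral>\<^sup>+\<theta>. G \<theta> * indicator {-pi/2<..<0} \<theta> + G \<theta> * indicator {0..<pi/2} \<theta> \<partial>lborel)"
    by (auto intro!: nn_integral_cong split: split_indicator)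
  also have "\<dots> = (\<integral>\<^sup>+\<theta>. G \<theta> * indicator {-pi/2<..<0} \<theta> \<partial>lborel) +
      (\<integral>\<^sup>+\<theta>. G \<theta> * indicator {0..<pi/2} \<theta> \<partial>lborel)"
    by (rule nn_integral_add) measurable
  also have "(\<integral>\<^sup>+\<theta>. G \<theta> * indicator {-pi/2<..<0} \<theta> \<partial>lborel) =
    (\<integral>\<^sup>+\<theta>. G (\<theta> - 2 * pi) * indicator {-pi/2<..<0} (\<theta> - 2 * pi) \<partial>lborel)"
    by (rule shift) measurable
  also have "\<dots> = (\<integral>\<^sup>+\<theta>. G \<theta> * indicator {3*pi/2<..<2*pi} \<theta> \<partial>lborel)"
    by (auto intro!: nn_integral_cong simp: periodic split: split_indicator)
  finally have right: "(\<integral>\<^sup>+x. \<integral>\<^sup>+y. F x y * indicator {0<..} x \<partial>lborel \<partial>lborel) =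
    (\<integral>\<^sup>+\<theta>. G \<theta> * indicator {3*pi/2<..<2*pi} \<theta> \<partial>lborel) +
    (\<integral>\<^sup>+\<theta>. G \<theta> * indicator {0..<pi/2} \<theta> \<partial>lborel)" .
  have "(\<integral>\<^sup>+x. \<integral>\<^sup>+y. F x y \<partial>lborel \<partial>lborel) =
    (\<integral>\<^sup>+x. (\<integral>\<^sup>+y. F x y * indicator {0<..} x \<partial>lborel) + (\<integral>\<^sup>+y. F x y * indicator {..<0} x \<partial>lborel) \<partial>lborel)"
  proof (rule nn_integral_cong_AE)
    show "AE x in lborel. (\<integral>\<^sup>+y. F x y \<partial>lborel) =
      (\<integral>\<^sup>+y. F x y * indicator {0<..} x \<partial>lborel) + (\<integral>\<^sup>+y. F x y * indicator {..<0} x \<partial>lborel)"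
      using AE_lborel_singleton[of 0] by eventually_elim (auto split: split_indicator)
  qed
  also have "\<dots> = (\<integral>\<^sup>+x. \<integral>\<^sup>+y. F x y * indicator {0<..} x \<partial>lborel \<partial>lborel) +
     (\<integral>\<^sup>+x. \<integral>\<^sup>+y. F x y * indicator {..<0} x \<partial>lborel \<partial>lborel)"
    by (rule nn_integral_add) measurable
  also have "\<dots> = (\<integral>\<^sup>+\<theta>. G \<theta> * indicator {3*pi/2<..<2*pi} \<theta> + G \<theta> * indicator {0..<pi/2} \<theta>
      + G \<theta> * indicator {pi/2<..<3*pi/2} \<theta> \<partial>lborel)"
    unfolding left right by (simp add: nn_integral_add)
  \<comment> \<open>The three pieces miss only the directions pi/2 and 3 pi/2.\<close>
  also have "\<dots> = (\<integral>\<^sup>+\<theta>. G \<theta> * indicator {0..<2 * pi} \<theta> \<partial>lborel)"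
  proof (rule nn_integral_cong_AE)
    show "AE \<theta> in lborel. G \<theta> * indicator {3*pi/2<..<2*pi} \<theta> + G \<theta> * indicator {0..<pi/2} \<theta>
      + G \<theta> * indicator {pi/2<..<3*pi/2} \<theta> = G \<theta> * indicator {0..<2 * pi} \<theta>"
      using AE_lborel_singleton[of "pi/2"] AE_lborel_singleton[of "3*pi/2"]
      by eventually_elim (auto split: split_indicator)
  qed
  finally show ?thesis unfolding G_def .
qed

section \<open>The rectangle in polar coordinates\<close>

text \<open>A ray from the origin that runs below the diagonal of [0,a] x [0,b] leaves through the
  side \<open>x = a\<close>, so the bound on the other coordinate is automatic. The strict and weak
  comparisons differ only on that side, which \<open>ne\<close> excludes; both are stated because a
  reflection exchanges them.\<close>

lemma below_diagonal_iff:
  fixes a b r \<phi> :: real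
  assumes "0 < a" "0 < b" "0 < r" "0 \<le> \<phi>" "\<phi> < arctan (b / a)" and ne: "r * cos \<phi> \<noteq> a"
  shows "(r < a \<or> r \<ge> a \<and> arccos (a / r) < \<phi>) \<longleftrightarrow> r * cos \<phi> \<le> a \<and> r * sin \<phi> \<le> b"
    and "(r < a \<or> r \<ge> a \<and> arccos (a / r) \<le> \<phi>) \<longleftrightarrow> r * cos \<phi> \<le> a \<and> r * sin \<phi> \<le> b"
proof -
  have \<phi>: "\<phi> < pi / 2" using assms arctan_ubound[of "b/a"] by linarith
  then have c: "cos \<phi> > 0" using assms by (intro cos_gt_zero_pi) auto
  have "tan \<phi> < tan (arctan (b / a))"
    using assms \<phi> arctan_ubound[of "b/a"] by (intro tan_monotone) auto
  then have "a * sin \<phi> \<le> b * cos \<phi>"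
    using c assms unfolding tan_arctan by (simp add: tan_def field_simps)
  then have *: "r * sin \<phi> \<le> b" if "r * cos \<phi> \<le> a"
  proof -
    have "a * (r * sin \<phi>) \<le> b * (r * cos \<phi>)"
      using \<open>a * sin \<phi> \<le> b * cos \<phi>\<close> assms by (simp add: mult.left_commute)
    also have "\<dots> \<le> b * a" using that assms by (intro mult_left_mono) auto
    finally show ?thesis using assms by (simp add: mult.commute)
  qed
  \<comment> \<open>With \<open>\<phi>\<close> written as \<open>arccos (cos \<phi>)\<close>,
    antitonicity of \<open>arccos\<close> on [-1, 1] turns angles into cosines;
    \<open>r \<ge> a\<close> puts \<open>a / r\<close> in that range.\<close>
  have "(arccos (a / r) \<le> \<phi>) = (r * cos \<phi> \<le> a)" "(arccos (a / r) < \<phi>) = (r * cos \<phi> < a)" if "r \<ge> a"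
  proof -
    have \<phi>_eq: "\<phi> = arccos (cos \<phi>)" using assms \<phi> by (simp add: arccos_cos)
    have "(arccos (a / r) \<le> \<phi>) = (cos \<phi> \<le> a / r)"
      using that assms by (subst \<phi>_eq, intro arccos_le_mono) auto
    then show "(arccos (a / r) \<le> \<phi>) = (r * cos \<phi> \<le> a)" using assms by (simp add: field_simps)
    have "(arccos (a / r) < \<phi>) = (cos \<phi> < a / r)"
      using that assms by (subst \<phi>_eq, intro arccos_less_mono) auto
    then show "(arccos (a / r) < \<phi>) = (r * cos \<phi> < a)" using assms by (simp add: field_simps)
  qed
  moreover have "r * cos \<phi> \<le> a" if "r < a"
    by (rule order.trans[of _ "r * 1"]) (use assms that in \<open>auto intro: mult_left_mono\<close>)
  ultimately show "(r < a \<or> r \<ge> a \<and> arccos (a / r) < \<phi>) \<longleftrightarrow> r * cos \<phi> \<le> a \<and> r * sin \<phi> \<le> b"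
    and "(r < a \<or> r \<ge> a \<and> arccos (a / r) \<le> \<phi>) \<longleftrightarrow> r * cos \<phi> \<le> a \<and> r * sin \<phi> \<le> b"
    using * ne by (metis less_le not_le)+
qed

lemma above_diagonal_iff:
  fixes a b r \<phi> :: real
  assumes "0 < a" "0 < b" "0 < r" "arctan (b / a) \<le> \<phi>" "\<phi> \<le> pi / 2" and ne: "r * sin \<phi> \<noteq> b"
  shows "(r < b \<or> r \<ge> b \<and> \<phi> < arcsin (b / r)) \<longleftrightarrow> r * cos \<phi> \<le> a \<and> r * sin \<phi> \<le> b"
    and "(r < b \<or> r \<ge> b \<and> \<phi> \<le> arcsin (b / r)) \<longleftrightarrow> r * cos \<phi> \<le> a \<and> r * sin \<phi> \<le> b"
proof -
  have pos: "0 < arctan (b / a)" using assms by simp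
  have *: "r * cos \<phi> \<le> a" if "r * sin \<phi> \<le> b"
  \<comment> \<open>The slope comparison needs a nonzero cosine, so the vertical ray is treated
    apart; its horizontal coordinate is 0.\<close>
  proof (cases "\<phi> = pi / 2")
    case True
    then show ?thesis using assms(1) by (simp only: cos_pi_half)
  next
    case False
    then have c: "cos \<phi> > 0"
      using assms(5) order.strict_trans2[OF pos assms(4)] by (intro cos_gt_zero_pi) linarith+
    have "tan (arctan (b / a)) \<le> tan \<phi>"
      using assms pos False pi_gt_zero by (intro tan_mono_le) linarith+
    then have "b * cos \<phi> \<le> a * sin \<phi>"
      using c assms unfolding tan_arctan by (simp add: tan_def field_simps)
    then have "b * (r * cos \<phi>) \<le> a * (r * sin \<phi>)"
      using assms by (simp add: mult.left_commute)
    also have "\<dots> \<le> a * b" using that assms by (intro mult_left_mono) auto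
    finally show ?thesis using assms by (simp add: mult.commute)
  qed
  have "(\<phi> < arcsin (b / r)) = (r * sin \<phi> < b)" "(\<phi> \<le> arcsin (b / r)) = (r * sin \<phi> \<le> b)" if "r \<ge> b"
  proof -
    have \<phi>_eq: "\<phi> = arcsin (sin \<phi>)"
      by (rule arcsin_sin[symmetric]) (use assms(4,5) pos in linarith)+
    have "(\<phi> < arcsin (b / r)) = (sin \<phi> < b / r)"
      using that assms by (subst \<phi>_eq, intro arcsin_less_mono) auto
    then show "(\<phi> < arcsin (b / r)) = (r * sin \<phi> < b)" using assms by (simp add: field_simps)
    have "(\<phi> \<le> arcsin (b / r)) = (sin \<phi> \<le> b / r)"
      using that assms by (subst \<phi>_eq, intro arcsin_le_mono) auto
    then show "(\<phi> \<le> arcsin (b / r)) = (r * sin \<phi> \<le> b)" using assms by (simp add: field_simps)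
  qed
  moreover have "r * sin \<phi> \<le> b" if "r < b"
    by (rule order.trans[of _ "r * 1"]) (use assms that in \<open>auto intro: mult_left_mono\<close>)
  ultimately show "(r < b \<or> r \<ge> b \<and> \<phi> < arcsin (b / r)) \<longleftrightarrow> r * cos \<phi> \<le> a \<and> r * sin \<phi> \<le> b"
    and "(r < b \<or> r \<ge> b \<and> \<phi> \<le> arcsin (b / r)) \<longleftrightarrow> r * cos \<phi> \<le> a \<and> r * sin \<phi> \<le> b"
    using * ne by (metis less_le not_le)+
qed

text \<open>Off the sides of the rectangle and the two directions \<open>\<gamma>\<^sub>2\<close>, \<open>\<gamma>\<^sub>4\<close> the half-open intervals of
  the density can be reflected into the first quadrant without tracking which endpoint is included.\<close>

lemma polar_density_eq:
  fixes lx ly ux uy r \<theta> :: real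
  assumes u: "\<bar>ux\<bar> < lx / 2" "\<bar>uy\<bar> < ly / 2" and r: "0 < r" and \<theta>: "0 \<le> \<theta>" "\<theta> < 2 * pi"
    and nd: "\<theta> \<noteq> gamma2 lx ly ux uy" "\<theta> \<noteq> gamma4 lx ly ux uy"
    and nr: "r * cos \<theta> \<noteq> hx_plus lx ux" "r * cos \<theta> \<noteq> hx_minus lx ux"
      "r * sin \<theta> \<noteq> hy_plus ly uy" "r * sin \<theta> \<noteq> hy_minus ly uy"
  shows "polar_density lx ly ux uy r \<theta> = r / (lx * ly) *
    indicator ({- lx / 2..lx / 2} \<times> {- ly / 2..ly / 2}) (ux + r * cos \<theta>, uy + r * sin \<theta>)"
proof -
  \<comment> \<open>These are the distances from \<open>u\<close> to the four sides, positive
    because \<open>u\<close> is interior.\<close>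
  define a b a' b' where ab: "a = hx_plus lx ux" "b = hy_plus ly uy"
    "a' = - hx_minus lx ux" "b' = - hy_minus ly uy"
  have pos: "0 < a" "0 < b" "0 < a'" "0 < b'"
    using u by (auto simp: ab hx_plus_def hy_plus_def hx_minus_def hy_minus_def)
  have hm: "hx_minus lx ux = - a'" "hy_minus ly uy = - b'" by (simp_all add: ab)
  \<comment> \<open>The acute angles between the corner directions and the horizontal axis: what the
    four gammas become once their quadrants are carried to the first one.\<close>
  define g1 g2 g3 g4 where g: "g1 = arctan (b / a)" "g2 = arctan (b / a')"
    "g3 = arctan (b' / a')" "g4 = arctan (b' / a)"
  have gb: "0 < g1" "g1 < pi/2" "0 < g2" "g2 < pi/2" "0 < g3" "g3 < pi/2" "0 < g4" "g4 < pi/2"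
    using pos arctan_ubound unfolding g by simp_all
  have gam: "gamma1 lx ly ux uy = g1" "gamma2 lx ly ux uy = pi - g2"
    "gamma3 lx ly ux uy = pi + g3" "gamma4 lx ly ux uy = 2 * pi - g4"
    by (simp_all add: gamma1_def gamma2_def gamma3_def gamma4_def g hm ab(1,2)[symmetric] arctan_minus)
  \<comment> \<open>The reflection rules hold only for arguments in [-1, 1], hence the guards, which
    agree with those in the density.\<close>
  have ac: "arccos (- (a' / r)) = pi - arccos (a' / r)" if "a' \<le> r"
    using that r pos by (intro arccos_minus) (auto simp: field_simps)
  have as: "arcsin (- (b' / r)) = - arcsin (b' / r)" if "b' \<le> r"
    using that r pos by (intro arcsin_minus) (auto simp: field_simps)
  have acb: "0 \<le> arccos (c / r)" and asb: "arcsin (c / r) \<le> pi / 2" if "0 < c" "c \<le> r" for c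
  proof -
    have "0 \<le> c / r" "c / r \<le> 1" using that r by auto
    then have "- 1 \<le> c / r" "c / r \<le> 1" by linarith+
    then show "0 \<le> arccos (c / r)" "arcsin (c / r) \<le> pi / 2"
      by (rule arccos_lbound, rule arcsin_ubound)
  qed
  note bounds = acb[OF pos(1)] acb[OF pos(3)] asb[OF pos(2)] asb[OF pos(4)] gb \<theta>
  \<comment> \<open>\<open>E1\<close> to \<open>E8\<close> are the conditions of the eight summands.
    Terms such as \<open>pi - - arcsin (b' / r)\<close> are the literal result of rewriting with
    \<open>ac\<close> and \<open>as\<close>.\<close>
  define E1 where "E1 \<longleftrightarrow> r < a \<and> 0 \<le> \<theta> \<and> \<theta> < g1 \<or> a \<le> r \<and> arccos (a / r) \<le> \<theta> \<and> \<theta> < g1"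
  define E2 where "E2 \<longleftrightarrow> r < a \<and> 2 * pi - g4 \<le> \<theta> \<and> \<theta> < 2 * pi \<or>
    a \<le> r \<and> 2 * pi - g4 \<le> \<theta> \<and> \<theta> < 2 * pi - arccos (a / r)"
  define E3 where "E3 \<longleftrightarrow> r < a' \<and> pi \<le> \<theta> \<and> \<theta> < pi + g3 \<or>
    a' \<le> r \<and> 2 * pi - (pi - arccos (a' / r)) \<le> \<theta> \<and> \<theta> < pi + g3"
  define E4 where "E4 \<longleftrightarrow> r < a' \<and> pi - g2 \<le> \<theta> \<and> \<theta> < pi \<or>
    a' \<le> r \<and> pi - g2 \<le> \<theta> \<and> \<theta> < pi - arccos (a' / r)"
  define E5 where "E5 \<longleftrightarrow> r < b \<and> g1 \<le> \<theta> \<and> \<theta> < pi / 2 \<or> b \<le> r \<and> g1 \<le> \<theta> \<and> \<theta> < arcsin (b / r)"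
  define E6 where "E6 \<longleftrightarrow> r < b \<and> pi / 2 \<le> \<theta> \<and> \<theta> < pi - g2 \<or>
    b \<le> r \<and> pi - arcsin (b / r) \<le> \<theta> \<and> \<theta> < pi - g2"
  define E7 where "E7 \<longleftrightarrow> r < b' \<and> pi + g3 \<le> \<theta> \<and> \<theta> < 3 * pi / 2 \<or>
    b' \<le> r \<and> pi + g3 \<le> \<theta> \<and> \<theta> < pi - - arcsin (b' / r)"
  define E8 where "E8 \<longleftrightarrow> r < b' \<and> 3 * pi / 2 \<le> \<theta> \<and> \<theta> < 2 * pi - g4 \<or>
    b' \<le> r \<and> 2 * pi + - arcsin (b' / r) \<le> \<theta> \<and> \<theta> < 2 * pi - g4"
  note E = E1_def E2_def E3_def E4_def E5_def E6_def E7_def E8_def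
  define P where "P \<longleftrightarrow> - a' \<le> r * cos \<theta> \<and> r * cos \<theta> \<le> a \<and> - b' \<le> r * sin \<theta> \<and> r * sin \<theta> \<le> b"
  have ind: "indicator ({- lx / 2..lx / 2} \<times> {- ly / 2..ly / 2}) (ux + r * cos \<theta>, uy + r * sin \<theta>) =
     (of_bool P :: real)"
    by (auto simp: P_def indicator_def ab hx_plus_def hy_plus_def hx_minus_def hy_minus_def)
  have guarded: "of_bool (r < c) * indicator {l..<u} \<theta> + of_bool (r \<ge> c) * indicator {l'..<u'} \<theta> =
    (of_bool (r < c \<and> l \<le> \<theta> \<and> \<theta> < u \<or> c \<le> r \<and> l' \<le> \<theta> \<and> \<theta> < u') :: real)" for c l u l' u'
    by (auto simp: indicator_def)
  have idx: "{1..8::nat} = {1,2,3,4,5,6,7,8}" by auto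
  have dens: "polar_density lx ly ux uy r \<theta> = r / (lx * ly) * (of_bool E1 + of_bool E2 + of_bool E3
      + of_bool E4 + of_bool E5 + of_bool E6 + of_bool E7 + of_bool E8)"
    unfolding polar_density_def idx h_def chi_less_def chi_geq_def guarded E
    \<comment> \<open>\<open>conj_cong\<close> lets each conjunct be rewritten under its guard,
      which \<open>ac\<close> and \<open>as\<close> require.\<close>
    by (simp add: gam hm ab(1,2)[symmetric] ac as cong: conj_cong)
  \<comment> \<open>Within one quadrant the coordinates have fixed signs, so only the two sides
    facing it constrain the point; \<open>c\<close> and \<open>d\<close> are their
    distances.\<close>
  have P_iff: "P \<longleftrightarrow> r * cos \<phi> \<le> c \<and> r * sin \<phi> \<le> d"
    if "0 \<le> \<phi>" "\<phi> \<le> pi / 2"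
      and "cos \<theta> = cos \<phi> \<and> c = a \<or> cos \<theta> = - cos \<phi> \<and> c = a'"
      and "sin \<theta> = sin \<phi> \<and> d = b \<or> sin \<theta> = - sin \<phi> \<and> d = b'" for \<phi> c d
  proof -
    have "0 \<le> r * cos \<phi>" "0 \<le> r * sin \<phi>"
      using that r cos_ge_zero[of \<phi>] sin_ge_zero[of \<phi>] by auto
    then show ?thesis using that(3,4) pos unfolding P_def by auto
  qed
  note below = below_diagonal_iff[OF _ _ r] and above = above_diagonal_iff[OF _ _ r]
  \<comment> \<open>The quadrant leaves two summands that can be nonzero, and the corner direction
    selects one of them. That one is equivalent to \<open>P\<close>.\<close>
  have "of_bool E1 + of_bool E2 + of_bool E3 + of_bool E4 + of_bool E5 + of_bool E6
      + of_bool E7 + of_bool E8 = (of_bool P :: real)"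
  proof -
    consider "\<theta> < pi / 2" | "pi / 2 \<le> \<theta>" "\<theta> < pi" | "pi \<le> \<theta>" "\<theta> < 3 * pi / 2" | "3 * pi / 2 \<le> \<theta>"
      by linarith
    then show ?thesis
    proof cases
      case 1
      then have P: "P \<longleftrightarrow> r * cos \<theta> \<le> a \<and> r * sin \<theta> \<le> b" using \<theta> by (intro P_iff) auto
      have "\<not> E2" "\<not> E3" "\<not> E4" "\<not> E6" "\<not> E7" "\<not> E8" unfolding E using 1 bounds by linarith+
      moreover have "\<theta> < g1 \<Longrightarrow> \<not> E5 \<and> (E1 \<longleftrightarrow> P)"
        using below(2)[of a b \<theta>] 1 bounds pos nr unfolding P E ab(1,2)[symmetric] g by auto
      moreover have "g1 \<le> \<theta> \<Longrightarrow> \<not> E1 \<and> (E5 \<longleftrightarrow> P)"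
        using above(1)[of a b \<theta>] 1 bounds pos nr unfolding P E ab(1,2)[symmetric] g by auto
      ultimately show ?thesis by (cases "\<theta> < g1") auto
    next
      case 2
      \<comment> \<open>Reflection in the vertical axis reverses the order of angles:
        \<open>E4\<close> becomes a strict comparison and \<open>E6\<close> a weak one. The
        direction \<open>\<phi> = g2\<close> would belong to \<open>E4\<close> but is not covered by
        \<open>below_diagonal_iff\<close>, hence its exclusion.\<close>
      define \<phi> where "\<phi> = pi - \<theta>"
      have \<phi>: "cos \<theta> = - cos \<phi>" "sin \<theta> = sin \<phi>" by (simp_all add: \<phi>_def)
      have P: "P \<longleftrightarrow> r * cos \<phi> \<le> a' \<and> r * sin \<phi> \<le> b"
        by (intro P_iff) (use 2 \<phi> in \<open>auto simp: \<phi>_def\<close>)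
      have ne: "r * cos \<phi> \<noteq> a'" "r * sin \<phi> \<noteq> b" "\<phi> \<noteq> g2"
        using nr nd unfolding \<phi> hm gam ab(2)[symmetric] by (auto simp: \<phi>_def)
      have "\<not> E1" "\<not> E2" "\<not> E3" "\<not> E5" "\<not> E7" "\<not> E8" unfolding E using 2 bounds by linarith+
      moreover have "\<not> E6 \<and> (E4 \<longleftrightarrow> P)" if "\<phi> < g2"
      proof -
        have "E4 \<longleftrightarrow> r < a' \<or> a' \<le> r \<and> arccos (a' / r) < \<phi>"
          using that 2 unfolding E \<phi>_def by linarith
        also have "\<dots> \<longleftrightarrow> P"
          unfolding P by (rule below(1)) (use pos that 2 ne in \<open>auto simp: g \<phi>_def\<close>)
        finally show ?thesis using that unfolding E6_def \<phi>_def by linarith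
      qed
      moreover have "\<not> E4 \<and> (E6 \<longleftrightarrow> P)" if "g2 < \<phi>"
      proof -
        have "E6 \<longleftrightarrow> r < b \<or> b \<le> r \<and> \<phi> \<le> arcsin (b / r)"
          using that 2 unfolding E \<phi>_def by linarith
        also have "\<dots> \<longleftrightarrow> P"
          unfolding P by (rule above(2)) (use pos that 2 ne in \<open>auto simp: g \<phi>_def\<close>)
        finally show ?thesis using that unfolding E4_def \<phi>_def by linarith
      qed
      ultimately show ?thesis using ne(3) by (cases "\<phi> < g2") auto
    next
      case 3
      \<comment> \<open>Rotation by pi preserves the order of angles, so the endpoints behave as in
        the first quadrant and no direction is excluded.\<close>
      define \<phi> where "\<phi> = \<theta> - pi"
      have \<phi>: "cos \<theta> = - cos \<phi>" "sin \<theta> = - sin \<phi>" by (simp_all add: \<phi>_def)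
      have P: "P \<longleftrightarrow> r * cos \<phi> \<le> a' \<and> r * sin \<phi> \<le> b'"
        by (intro P_iff) (use 3 \<phi> in \<open>auto simp: \<phi>_def\<close>)
      have ne: "r * cos \<phi> \<noteq> a'" "r * sin \<phi> \<noteq> b'"
        using nr unfolding \<phi> hm by auto
      have "\<not> E1" "\<not> E2" "\<not> E4" "\<not> E5" "\<not> E6" "\<not> E8" unfolding E using 3 bounds by linarith+
      moreover have "\<not> E7 \<and> (E3 \<longleftrightarrow> P)" if "\<phi> < g3"
      proof -
        have "E3 \<longleftrightarrow> r < a' \<or> a' \<le> r \<and> arccos (a' / r) \<le> \<phi>"
          using that 3 unfolding E \<phi>_def by linarith
        also have "\<dots> \<longleftrightarrow> P"
          unfolding P by (rule below(2)) (use pos that 3 ne in \<open>auto simp: g \<phi>_def\<close>)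
        finally show ?thesis using that unfolding E7_def \<phi>_def by linarith
      qed
      moreover have "\<not> E3 \<and> (E7 \<longleftrightarrow> P)" if "g3 \<le> \<phi>"
      proof -
        have "E7 \<longleftrightarrow> r < b' \<or> b' \<le> r \<and> \<phi> < arcsin (b' / r)"
          using that 3 unfolding E \<phi>_def by linarith
        also have "\<dots> \<longleftrightarrow> P"
          unfolding P by (rule above(1)) (use pos that 3 ne in \<open>auto simp: g \<phi>_def\<close>)
        finally show ?thesis using that unfolding E3_def \<phi>_def by linarith
      qed
      ultimately show ?thesis by (cases "\<phi> < g3") auto
    next
      case 4
      \<comment> \<open>Reflection in the horizontal axis reverses the order again;
        \<open>g4\<close> takes the place of \<open>g2\<close>.\<close>
      define \<phi> where "\<phi> = 2 * pi - \<theta>"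
      have \<phi>: "cos \<theta> = cos \<phi>" "sin \<theta> = - sin \<phi>" by (simp_all add: \<phi>_def cos_diff sin_diff)
      have P: "P \<longleftrightarrow> r * cos \<phi> \<le> a \<and> r * sin \<phi> \<le> b'"
        by (intro P_iff) (use 4 \<theta> \<phi> in \<open>auto simp: \<phi>_def\<close>)
      have ne: "r * cos \<phi> \<noteq> a" "r * sin \<phi> \<noteq> b'" "\<phi> \<noteq> g4"
        using nr nd unfolding \<phi> hm gam ab(1)[symmetric] by (auto simp: \<phi>_def)
      have "\<not> E1" "\<not> E3" "\<not> E4" "\<not> E5" "\<not> E6" "\<not> E7" unfolding E using 4 bounds by linarith+
      moreover have "\<not> E8 \<and> (E2 \<longleftrightarrow> P)" if "\<phi> < g4"
      proof -
        have "E2 \<longleftrightarrow> r < a \<or> a \<le> r \<and> arccos (a / r) < \<phi>"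
          using that 4 \<theta> unfolding E \<phi>_def by linarith
        also have "\<dots> \<longleftrightarrow> P"
          unfolding P by (rule below(1)) (use pos that 4 \<theta> ne in \<open>auto simp: g \<phi>_def\<close>)
        finally show ?thesis using that unfolding E8_def \<phi>_def by linarith
      qed
      moreover have "\<not> E2 \<and> (E8 \<longleftrightarrow> P)" if "g4 < \<phi>"
      proof -
        have "E8 \<longleftrightarrow> r < b' \<or> b' \<le> r \<and> \<phi> \<le> arcsin (b' / r)"
          using that 4 unfolding E \<phi>_def by linarith
        also have "\<dots> \<longleftrightarrow> P"
          unfolding P by (rule above(2)) (use pos that 4 \<theta> ne in \<open>auto simp: g \<phi>_def\<close>)
        finally show ?thesis using that unfolding E2_def \<phi>_def by linarith
      qed
      ultimately show ?thesis using ne(3) by (cases "\<phi> < g4") auto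
    qed
  qed
  then show ?thesis unfolding dens ind by simp
qed

section \<open>The joint density\<close>

text \<open>Inverts polar coordinates away from the origin; the value at the origin is junk.\<close>

definition azimuth :: "real \<Rightarrow> real \<Rightarrow> real" where
  "azimuth x y = (if 0 \<le> y then arccos (x / sqrt (x\<^sup>2 + y\<^sup>2)) else 2 * pi - arccos (x / sqrt (x\<^sup>2 + y\<^sup>2)))"

lemma measurable_azimuth [measurable (raw)]:
  assumes [measurable]: "f \<in> borel_measurable N" "g \<in> borel_measurable N"
  shows "(\<lambda>x. azimuth (f x) (g x)) \<in> borel_measurable N"
  unfolding azimuth_def by measurable

lemma radius_polar: "0 \<le> r \<Longrightarrow> sqrt ((r * cos \<theta>)\<^sup>2 + (r * sin \<theta>)\<^sup>2) = r" for r \<theta> :: real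
  by (simp add: power_mult_distrib flip: distrib_left)

text \<open>\<open>arccos\<close> inverts the cosine on [0, pi] only. An angle beyond pi shares its
  cosine with \<open>2 * pi - \<theta>\<close>, which lies in that range, and the sign of
  \<open>y\<close> tells the two cases apart; the angles 0 and pi, where \<open>y = 0\<close>, fall
  under the first branch.\<close>

lemma azimuth_polar:
  fixes r \<theta> :: real
  assumes "0 < r" "0 \<le> \<theta>" "\<theta> < 2 * pi"
  shows "azimuth (r * cos \<theta>) (r * sin \<theta>) = \<theta>"
proof (cases "\<theta> \<le> pi")
  case True
  then have "0 \<le> r * sin \<theta>" using assms by (simp add: sin_ge_zero)
  then show ?thesis using assms True by (simp add: azimuth_def radius_polar arccos_cos)
next
  case False
  then have "r * sin \<theta> < 0" using assms by (intro mult_pos_neg sin_lt_zero) auto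
  moreover have "arccos (cos (2 * pi - \<theta>)) = 2 * pi - \<theta>"
    using False assms by (intro arccos_cos) auto
  ultimately show ?thesis using assms by (simp add: azimuth_def radius_polar cos_diff)
qed

lemma measurable_polar_density [measurable]:
  "(\<lambda>(r, \<theta>). polar_density lx ly ux uy r \<theta>) \<in> borel_measurable (borel \<Otimes>\<^sub>M borel)"
proof -
  have [measurable]: "(\<lambda>x. indicator {f x..<g x} (\<theta> x) :: real) \<in> borel_measurable N"
    if [measurable]: "f \<in> borel_measurable N" "g \<in> borel_measurable N" "\<theta> \<in> borel_measurable N"
    for f g \<theta> :: "real \<times> real \<Rightarrow> real" and N
    unfolding indicator_def by simp
  \<comment> \<open>The restriction to 1, ..., 8 makes the list access explicit, so that
    measurability is checked entry by entry.\<close>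
  have [measurable]: "(\<lambda>r. fst (chi_geq lx ly ux uy i r)) \<in> borel_measurable borel"
    "(\<lambda>r. snd (chi_geq lx ly ux uy i r)) \<in> borel_measurable borel" if "i \<in> {1..8}" for i
  proof -
    have "i \<in> {1,2,3,4,5,6,7,8}" using that by auto
    then show "(\<lambda>r. fst (chi_geq lx ly ux uy i r)) \<in> borel_measurable borel"
      "(\<lambda>r. snd (chi_geq lx ly ux uy i r)) \<in> borel_measurable borel"
      unfolding chi_geq_def by auto
  qed
  show ?thesis unfolding polar_density_def split_beta of_bool_def by measurable
qed

text \<open>Away from two directions, a ray meets each of the four side lines at one radius at most.
  Fixing the angle first matches the order of the iterated polar integral.\<close>

lemma AE_polar_density_eq:
  fixes lx ly ux uy :: real
  assumes u: "\<bar>ux\<bar> < lx / 2" "\<bar>uy\<bar> < ly / 2"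
  shows "AE \<theta> in lborel. AE r in lborel. 0 < r \<longrightarrow> \<theta> \<in> {0..<2 * pi} \<longrightarrow>
    polar_density lx ly ux uy r \<theta> = r / (lx * ly) *
      indicator ({- lx / 2..lx / 2} \<times> {- ly / 2..ly / 2}) (ux + r * cos \<theta>, uy + r * sin \<theta>)"
proof -
  \<comment> \<open>For \<open>c = 0\<close> the ray is parallel to the side line and, as
    \<open>d\<close> is nonzero, never meets it.\<close>
  have mult_ne: "AE r in lborel. r * c \<noteq> d" if "d \<noteq> 0" for c d :: real
  proof (cases "c = 0")
    case False
    show ?thesis using AE_lborel_singleton[of "d / c"]
      by eventually_elim (use False in auto)
  qed (use that in simp)
  have nz: "hx_plus lx ux \<noteq> 0" "hx_minus lx ux \<noteq> 0" "hy_plus ly uy \<noteq> 0" "hy_minus ly uy \<noteq> 0"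
    using u by (auto simp: hx_plus_def hx_minus_def hy_plus_def hy_minus_def)
  show ?thesis
    using AE_lborel_singleton[of "gamma2 lx ly ux uy"] AE_lborel_singleton[of "gamma4 lx ly ux uy"]
  proof eventually_elim
    case (elim \<theta>)
    show ?case
      using mult_ne[OF nz(1), of "cos \<theta>"] mult_ne[OF nz(2), of "cos \<theta>"]
        mult_ne[OF nz(3), of "sin \<theta>"] mult_ne[OF nz(4), of "sin \<theta>"]
      by eventually_elim (intro impI polar_density_eq, use elim u in auto)
  qed
qed

theorem corollary3:
  fixes M :: "'a measure"
    and V :: "'a \<Rightarrow> real \<times> real"
    and R \<Theta> :: "'a \<Rightarrow> real"
    and lx ly ux uy :: real
  assumes "prob_space M"
    and "lx > 0" and "ly > 0"
    and "\<bar>ux\<bar> < lx / 2" and "\<bar>uy\<bar> < ly / 2"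
    and "V \<in> borel_measurable M"
    and "distr M lborel V = uniform_measure lborel ({- lx / 2..lx / 2} \<times> {- ly / 2..ly / 2})"
    and "R \<in> borel_measurable M" and "\<Theta> \<in> borel_measurable M"
    and "\<And>\<omega>. \<omega> \<in> space M \<Longrightarrow> R \<omega> \<ge> 0"
    and "\<And>\<omega>. \<omega> \<in> space M \<Longrightarrow> \<Theta> \<omega> \<in> {0..<2 * pi}"
    and "\<And>\<omega>. \<omega> \<in> space M \<Longrightarrow>
           V \<omega> - (ux, uy) = (R \<omega> * cos (\<Theta> \<omega>), R \<omega> * sin (\<Theta> \<omega>))"
  shows "distributed M lborel (\<lambda>\<omega>. (R \<omega>, \<Theta> \<omega>))
    (\<lambda>(r, \<theta>). ennreal (polar_density lx ly ux uy r \<theta>) * indicator ({0<..} \<times> {0..<2 * pi}) (r, \<theta>))"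
    (is "distributed M lborel ?X ?f")
proof -
  note [measurable] = assms(6,8,9)
  let ?D = "{- lx / 2..lx / 2} \<times> {- ly / 2..ly / 2}"
  have D: "?D = cbox (- lx / 2, - ly / 2) (lx / 2, ly / 2)"
    by (auto simp: cbox_Pair_eq)
  have D_sets [measurable]: "?D \<in> sets borel" unfolding D by simp
  have area: "emeasure lborel ?D = ennreal (lx * ly)"
    using assms(2,3) unfolding D
    by (subst emeasure_lborel_cbox_eq) (auto simp: Basis_prod_def)
  have f [measurable]: "?f \<in> borel_measurable borel"
    unfolding borel_prod[symmetric] by measurable
  \<comment> \<open>At \<open>V = u\<close> the angle is not determined by \<open>V\<close>, so the
    formula is restricted to the complement of this event.\<close>
  have polar: "?X \<omega> = (sqrt ((fst (V \<omega>) - ux)\<^sup>2 + (snd (V \<omega>) - uy)\<^sup>2),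
      azimuth (fst (V \<omega>) - ux) (snd (V \<omega>) - uy))"
    if \<omega>: "\<omega> \<in> space M" and ne: "V \<omega> \<noteq> (ux, uy)" for \<omega>
  proof -
    have eq: "fst (V \<omega>) - ux = R \<omega> * cos (\<Theta> \<omega>)" "snd (V \<omega>) - uy = R \<omega> * sin (\<Theta> \<omega>)"
      using assms(12)[OF \<omega>] by (auto simp: prod_eq_iff)
    have "R \<omega> \<noteq> 0" using ne eq by (auto simp: prod_eq_iff)
    then have "R \<omega> > 0" using assms(10)[OF \<omega>] by simp
    then show ?thesis using assms(11)[OF \<omega>] unfolding eq by (simp add: radius_polar azimuth_polar)
  qed
  have AE_V: "AE \<omega> in M. V \<omega> \<noteq> (ux, uy)"
  proof -
    have "AE v in uniform_measure lborel ?D. v \<noteq> (ux, uy)"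
    proof (rule AE_uniform_measureI)
      show "AE v in lborel. v \<in> ?D \<longrightarrow> v \<noteq> (ux, uy)"
        using AE_lborel_singleton[of "(ux, uy)"] by eventually_elim simp
    qed (use D_sets in \<open>simp only: sets_lborel\<close>)
    then have "AE v in distr M lborel V. v \<noteq> (ux, uy)" by (simp only: assms(7))
    then show ?thesis by (subst (asm) AE_distr_iff) auto
  qed
  have "distr M lborel ?X = density lborel ?f"
  proof (rule measure_eqI)
    fix A :: "(real \<times> real) set"
    assume "A \<in> sets (distr M lborel ?X)"
    then have [measurable]: "A \<in> sets borel" by simp
    have [measurable]: "A \<in> sets (borel \<Otimes>\<^sub>M borel)" "?D \<in> sets (borel \<Otimes>\<^sub>M borel)"
      unfolding borel_prod by measurable
    \<comment> \<open>\<open>G\<close> is the event \<open>(R, \<Theta>) \<in> A\<close> as a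
      function of \<open>V\<close>; \<open>F\<close> is \<open>G\<close> times the uniform density,
      in coordinates centred at \<open>u\<close>.\<close>
    define F :: "real \<Rightarrow> real \<Rightarrow> ennreal" where
      "F x y = indicator A (sqrt (x\<^sup>2 + y\<^sup>2), azimuth x y) * (indicator ?D (ux + x, uy + y) / ennreal (lx * ly))" for x y
    have F [measurable]: "case_prod F \<in> borel_measurable (borel \<Otimes>\<^sub>M borel)"
      unfolding F_def by measurable
    define G :: "real \<times> real \<Rightarrow> ennreal" where
      "G v = indicator A (sqrt ((fst v - ux)\<^sup>2 + (snd v - uy)\<^sup>2), azimuth (fst v - ux) (snd v - uy))" for v
    have G [measurable]: "G \<in> borel_measurable borel"
      unfolding G_def borel_prod[symmetric] by measurable
    have shift: "(\<integral>\<^sup>+x. g (x - c) \<partial>lborel) = (\<integral>\<^sup>+x. g x \<partial>lborel)"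
      if "g \<in> borel_measurable borel" for g :: "real \<Rightarrow> ennreal" and c
      using nn_integral_real_affine[OF that, of 1 "-c"] by simp
    have "emeasure (distr M lborel ?X) A = (\<integral>\<^sup>+x. indicator A x \<partial>distr M lborel ?X)"
      by simp
    also have "\<dots> = (\<integral>\<^sup>+\<omega>. indicator A (?X \<omega>) \<partial>M)"
      by (rule nn_integral_distr) auto
    \<comment> \<open>From here on only the law of \<open>V\<close> matters.\<close>
    also have "\<dots> = (\<integral>\<^sup>+\<omega>. G (V \<omega>) \<partial>M)"
    proof (rule nn_integral_cong_AE)
      show "AE \<omega> in M. indicator A (?X \<omega>) = G (V \<omega>)"
        using AE_V AE_space by eventually_elim (unfold G_def, rule arg_cong[OF polar])
    qed
    also have "\<dots> = (\<integral>\<^sup>+v. G v \<partial>distr M lborel V)"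
      by (rule nn_integral_distr[symmetric]) simp_all
    also have "\<dots> = (\<integral>\<^sup>+v. indicator ?D v / emeasure lborel ?D * G v \<partial>lborel)"
      unfolding assms(7) uniform_measure_def
      by (rule nn_integral_density) (use D_sets in measurable)
    also have "\<dots> = (\<integral>\<^sup>+v. F (fst v - ux) (snd v - uy) \<partial>lborel)"
      unfolding area F_def G_def by (rule nn_integral_cong) (simp add: mult.commute)
    \<comment> \<open>Tonelli first; then translating each coordinate moves \<open>u\<close> to the
      origin.\<close>
    also have "\<dots> = (\<integral>\<^sup>+x. \<integral>\<^sup>+y. F (x - ux) (y - uy) \<partial>lborel \<partial>lborel)"
      unfolding lborel_prod[symmetric]
      by (subst lborel.nn_integral_fst[symmetric]) (simp_all, measurable)
    also have "\<dots> = (\<integral>\<^sup>+x. \<integral>\<^sup>+y. F (x - ux) y \<partial>lborel \<partial>lborel)"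
      by (intro nn_integral_cong shift) measurable
    also have "\<dots> = (\<integral>\<^sup>+x. \<integral>\<^sup>+y. F x y \<partial>lborel \<partial>lborel)"
      by (rule shift) measurable
    also have "\<dots> = (\<integral>\<^sup>+\<theta>. (\<integral>\<^sup>+r. F (r * cos \<theta>) (r * sin \<theta>) * ennreal r * indicator {0<..} r \<partial>lborel)
      * indicator {0..<2 * pi} \<theta> \<partial>lborel)"
      by (rule nn_integral_polar) measurable
    \<comment> \<open>In polar coordinates radius and \<open>azimuth\<close> return \<open>r\<close>
      and \<open>\<theta>\<close>, so the indicator of \<open>A\<close> is evaluated at
      \<open>(r, \<theta>)\<close>; the rest is the density, by
      \<open>AE_polar_density_eq\<close>.\<close>
    also have "\<dots> = (\<integral>\<^sup>+\<theta>. \<integral>\<^sup>+r. ?f (r, \<theta>) * indicator A (r, \<theta>) \<partial>lborel \<partial>lborel)"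
    proof (rule nn_integral_cong_AE)
      show "AE \<theta> in lborel. (\<integral>\<^sup>+r. F (r * cos \<theta>) (r * sin \<theta>) * ennreal r * indicator {0<..} r \<partial>lborel)
          * indicator {0..<2 * pi} \<theta> = (\<integral>\<^sup>+r. ?f (r, \<theta>) * indicator A (r, \<theta>) \<partial>lborel)"
        using AE_polar_density_eq[OF assms(4,5)]
      proof eventually_elim
        case (elim \<theta>)
        show ?case
        proof (cases "\<theta> \<in> {0..<2 * pi}")
          case True
          have "(\<integral>\<^sup>+r. F (r * cos \<theta>) (r * sin \<theta>) * ennreal r * indicator {0<..} r \<partial>lborel) =
            (\<integral>\<^sup>+r. ?f (r, \<theta>) * indicator A (r, \<theta>) \<partial>lborel)"
          proof (rule nn_integral_cong_AE)
            show "AE r in lborel. F (r * cos \<theta>) (r * sin \<theta>) * ennreal r * indicator {0<..} r =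
              ?f (r, \<theta>) * indicator A (r, \<theta>)"
              using elim
            proof eventually_elim
              case (elim r)
              show ?case
              proof (cases "r > 0")
                case r: True
                have "ennreal r / ennreal (lx * ly) = ennreal (r / (lx * ly))"
                  using r assms(2,3) by (intro divide_ennreal) auto
                then have "1 / ennreal (lx * ly) * ennreal r = ennreal (r / (lx * ly))"
                  by (simp add: ennreal_times_divide mult.commute)
                then show ?thesis
                  using elim r True assms(2,3)
                  by (auto simp: F_def radius_polar azimuth_polar mult.assoc split: split_indicator)
              qed simp
            qed
          qed
          then show ?thesis using True by simp
        qed simp
      qed
    qed
    \<comment> \<open>The angle is the outer variable here, hence Tonelli in the form that
      integrates the second coordinate last.\<close>
    also have "\<dots> = (\<integral>\<^sup>+x. ?f x * indicator A x \<partial>lborel)"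
      unfolding lborel_prod[symmetric]
      by (rule lborel_pair.nn_integral_snd) simp
    also have "\<dots> = emeasure (density lborel ?f) A"
      by (simp add: emeasure_density)
    finally show "emeasure (distr M lborel ?X) A = emeasure (density lborel ?f) A" .
  qed simp
  then show ?thesis unfolding distributed_def by simp
qed

end
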